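(* Let $n, m \ge 1$ be integers and let $0 < p \le 1$. Let $G(n,m,p)$ be the random binomial bipartite graph with parts of sizes $n$ and $m$ and edge probability $p$, and let $P_{n,m}(p)$ be the probability that $G(n,m,p)$ is connected. Let $X_1,\dots,X_n,Y_1,\dots,Y_m$ be mutually independent random variables with $$X_i \sim \mathrm{Poiss}(\alpha_i),\quad \alpha_i = \frac{mp}{1-(1-p)^n}(1-p)^{i-1},\quad 1\le i\le n,$$ $$Y_j \sim \mathrm{Poiss}(\beta_j),\quad \beta_j = \frac{np}{1-(1-p)^m}(1-p)^{j-1},\quad 1\le j\le m.$$ Define $$A_k = \sum_{i=1}^k X_i \ (0\le k\le n),\qquad B_k = \sum_{j=1}^k Y_j\ (0\le k\le m),\qquad S_k = B_{A_k} - k.$$ Then $$P_{n,m}(p) = \left(1-(1-p)^n\right)^m\left(1-(1-p)^m\right)^{n-1}\,\mathbf{P}\left(S_k \ge 0 \text{ for all } 0<k<n \ \middle|\ A_n = m,\ B_m = n-1\right).$$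
   Context: The random binomial bipartite graph $G(n,m,p)$ has vertex set partitioned into two disjoint parts $V_1$ with $|V_1| = n$ and $V_2$ with $|V_2| = m$; each of the $nm$ possible edges joining a vertex of $V_1$ to a vertex of $V_2$ is included independently with probability $p$, and there are no other edges. $\mathrm{Poiss}(\lambda)$ denotes the Poisson distribution with mean $\lambda$; $\mathrm{Poiss}(0)$ is the point mass at $0$, and $(1-p)^0 = 1$. Empty sums are $0$, so $A_0=B_0=0$. On the conditioning event $\{A_n = m\}$ one has $A_k \le m$ for all $k\le n$, so $B_{A_k}$ (the value of $B$ at the random index $A_k$) is well defined there. *)

theory Defs
  imports "HOL-Probability.Probability" "Graph_Theory.Graph_Theory"
begin

text \<open>
  The library's \<open>poisson_pmf\<close> is specified for positive rates only; the point mass at 0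
  is the degenerate case of rate 0, which occurs below for \<open>p = 1\<close>.
\<close>

definition poiss :: "real \<Rightarrow> nat pmf" where
  "poiss r = (if r = 0 then return_pmf 0 else poisson_pmf r)"

text \<open>
  Undirected graphs are represented, as in the graph library, by symmetric digraphs.
  The vertex \<open>i\<close> of the first part is \<open>Inl i\<close>, the vertex \<open>j\<close> of the second part is \<open>Inr j\<close>,
  and the edge between them is present iff \<open>e (i, j)\<close>.
\<close>

definition bip_graph :: "nat \<Rightarrow> nat \<Rightarrow> (nat \<times> nat \<Rightarrow> bool) \<Rightarrow> (nat + nat) pair_pre_digraph" where
  "bip_graph n m e =
     \<lparr> pverts = {1..n} <+> {1..m},
       parcs = {(Inl i, Inr j) | i j. i \<in> {1..n} \<and> j \<in> {1..m} \<and> e (i, j)} \<union>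
               {(Inr j, Inl i) | i j. i \<in> {1..n} \<and> j \<in> {1..m} \<and> e (i, j)} \<rparr>"

lemma pair_graph_bip_graph: "pair_graph (bip_graph n m e)"
proof -
  let ?V = "{1..n} <+> {1..m}"
  have verts: "pverts (bip_graph n m e) = ?V"
    by (simp add: bip_graph_def)
  have sub: "parcs (bip_graph n m e) \<subseteq> ?V \<times> ?V"
    unfolding bip_graph_def by force
  have fin: "finite ?V"
    by simp
  show ?thesis
  proof (unfold_locales, goal_cases)
    case (1 a)
    then show ?case using sub unfolding verts by force
  next
    case (2 a)
    then show ?case using sub unfolding verts by force
  next
    case 3
    show ?case unfolding verts by (rule fin)
  next
    case 4
    show ?case using fin finite_subset[OF sub] by simp
  next
    case (5 a)
    then show ?case unfolding bip_graph_def by force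
  next
    case 6
    show ?case unfolding symmetric_def with_proj_simps
      by (rule symI) (simp add: bip_graph_def, blast)
  qed
qed

definition random_bip_graph :: "nat \<Rightarrow> nat \<Rightarrow> real \<Rightarrow> (nat + nat) pair_pre_digraph pmf" where
  "random_bip_graph n m p =
     map_pmf (bip_graph n m) (Pi_pmf ({1..n} \<times> {1..m}) False (\<lambda>_. bernoulli_pmf p))"

definition prob_connected :: "nat \<Rightarrow> nat \<Rightarrow> real \<Rightarrow> real" where
  "prob_connected n m p =
     measure_pmf.prob (random_bip_graph n m p) {G. Digraph_Component.connected (with_proj G)}"

end

theory Submission
  imports Defs
begin

text \<open>
  Explore the graph from vertex 1 of the first part: a queued vertex of the first part reveals its
  \<open>x\<close> neighbours among the undiscovered vertices of the second part, and these reveal their neighbours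
  among the undiscovered vertices of the first part. If \<open>b\<close> and \<open>a\<close> vertices of the second and first
  part were undiscovered, then \<open>x\<close> is binomial with parameters \<open>b\<close>, \<open>p\<close>, and the number of new
  vertices of the first part is binomial with parameters \<open>a\<close>, \<open>1 - (1 - p) ^ x\<close>. The graph is
  connected iff the queue does not run empty before every vertex has been found.

  On the other side, conditioning on \<open>A n = m\<close> and \<open>B m = n - 1\<close> makes \<open>(X i)\<close> and \<open>(Y j)\<close>
  independent multinomial vectors whose cell probabilities are proportional to \<open>p * (1 - p) ^ (i - 1)\<close>.
  Splitting off \<open>X 1 = x\<close> and \<open>Y 1, \<dots>, Y x\<close> gives the same recursion, where \<open>S\<close> tracks the queue
  length. The powers of \<open>1 - (1 - p) ^ n\<close> and \<open>1 - (1 - p) ^ m\<close> are the normalising constants of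
  the multinomial weights.
\<close>

section \<open>Random subsets\<close>

text \<open>The expectation of \<open>g\<close> at a random subset of \<open>D\<close> that contains each element independently
  with probability \<open>r\<close>.\<close>
definition bexp :: "real \<Rightarrow> 'a set \<Rightarrow> ('a set \<Rightarrow> real) \<Rightarrow> real" where
  "bexp r D g = (\<Sum>E\<in>Pow D. r ^ card E * (1 - r) ^ card (D - E) * g E)"

lemma bexp_empty [simp]: "bexp r {} g = g {}"
  by (simp add: bexp_def)

lemma bexp_cong: "(\<And>E. E \<subseteq> D \<Longrightarrow> g E = h E) \<Longrightarrow> bexp r D g = bexp r D h"
  by (simp add: bexp_def)

text \<open>Conditioning on whether \<open>d\<close> is chosen; the inductions on finite sets below
  rest on this.\<close>

lemma bexp_insert:
  assumes "finite D" "d \<notin> D"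
  shows "bexp r (insert d D) g = r * bexp r D (\<lambda>E. g (insert d E)) + (1 - r) * bexp r D g"
proof -
  have inj: "inj_on (insert d) (Pow D)"
    using assms(2) by (auto simp: inj_on_def)
  have card_insert: "card (insert d E) = Suc (card E)" "card (insert d D - E) = Suc (card (D - E))"
    "D - insert d E = D - E" if "E \<subseteq> D" for E
  proof -
    have "finite E" "d \<notin> E" using that assms finite_subset by auto
    then show "card (insert d E) = Suc (card E)" by simp
    have "insert d D - E = insert d (D - E)" using \<open>d \<notin> E\<close> by auto
    then show "card (insert d D - E) = Suc (card (D - E))" using assms by simp
    show "D - insert d E = D - E" using assms by auto
  qed
  have "bexp r (insert d D) g =
      (\<Sum>E\<in>Pow D. r ^ card E * (1 - r) ^ card (insert d D - E) * g E) +
      (\<Sum>E\<in>insert d ` Pow D. r ^ card E * (1 - r) ^ card (insert d D - E) * g E)"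
    unfolding bexp_def Pow_insert using assms by (intro sum.union_disjoint) auto
  also have "(\<Sum>E\<in>insert d ` Pow D. r ^ card E * (1 - r) ^ card (insert d D - E) * g E) =
      r * bexp r D (\<lambda>E. g (insert d E))"
    unfolding sum.reindex[OF inj] bexp_def sum_distrib_left
    by (intro sum.cong) (auto simp: card_insert)
  also have "(\<Sum>E\<in>Pow D. r ^ card E * (1 - r) ^ card (insert d D - E) * g E) = (1 - r) * bexp r D g"
    unfolding bexp_def sum_distrib_left
    by (intro sum.cong) (auto simp: card_insert)
  finally show ?thesis by simp
qed

lemma bexp_const [simp]: "finite D \<Longrightarrow> bexp r D (\<lambda>_. c) = c"
  by (induction D rule: finite_induct) (simp_all add: bexp_insert algebra_simps)

text \<open>Independence: the choices inside disjoint sets can be averaged one after the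
  other.\<close>

lemma bexp_Un:
  assumes "finite C" "finite D" "C \<inter> D = {}"
  shows "bexp r (C \<union> D) g = bexp r C (\<lambda>E. bexp r D (\<lambda>F. g (E \<union> F)))"
  using assms
proof (induction C arbitrary: g rule: finite_induct)
  case (insert c C)
  then show ?case by (simp add: bexp_insert)
qed simp

lemma bexp_singleton_Times:
  assumes "finite W"
  shows "bexp r ({s} \<times> W) g = bexp r W (\<lambda>N. g ({s} \<times> N))"
proof -
  have inj: "inj_on (\<lambda>N. {s} \<times> N) (Pow W)" by (auto simp: inj_on_def)
  have Pow: "Pow ({s} \<times> W) = (\<lambda>N. {s} \<times> N) ` Pow W"
  proof (intro equalityI subsetI)
    fix E assume "E \<in> Pow ({s} \<times> W)"
    then have "E = {s} \<times> snd ` E" "snd ` E \<in> Pow W" by force+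
    then show "E \<in> (\<lambda>N. {s} \<times> N) ` Pow W" by blast
  qed auto
  show ?thesis
    unfolding bexp_def Pow sum.reindex[OF inj]
    by (simp add: card_cartesian_product flip: Sigma_Diff_distrib2)
qed

lemma bexp_eq_empty:
  assumes "finite N"
  shows "bexp r N (\<lambda>E. if E = {} then a else b) = (1 - r) ^ card N * a + (1 - (1 - r) ^ card N) * b"
  using assms
proof (induction N rule: finite_induct)
  case (insert x N)
  then show ?case
    by (simp add: bexp_insert) (simp add: algebra_simps)
qed simp

text \<open>A vertex of \<open>U\<close> has no neighbour in \<open>N\<close> with probability \<open>(1 - r) ^ card N\<close>, independently
  of the others.\<close>
lemma bexp_Times_fst:
  assumes "finite U" "finite N"
  shows "bexp r (U \<times> N) (\<lambda>F. h (fst ` F)) = bexp (1 - (1 - r) ^ card N) U h"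
  using assms(1)
proof (induction U arbitrary: h rule: finite_induct)
  case (insert u U)
  have "insert u U \<times> N = {u} \<times> N \<union> U \<times> N" by auto
  then have "bexp r (insert u U \<times> N) (\<lambda>F. h (fst ` F)) =
      bexp r N (\<lambda>E. bexp r (U \<times> N) (\<lambda>F. h (fst ` ({u} \<times> E \<union> F))))"
    using insert assms by (simp only:) (subst bexp_Un, auto simp: bexp_singleton_Times)
  \<comment> \<open>\<open>u\<close> lies in the projection iff its own edge set \<open>E\<close> is
    nonempty.\<close>
  also have "\<dots> = bexp r N (\<lambda>E. if E = {} then bexp r (U \<times> N) (\<lambda>F. h (fst ` F))
      else bexp r (U \<times> N) (\<lambda>F. h (insert u (fst ` F))))"
    by (intro bexp_cong) (auto simp: image_Un)
  also have "\<dots> = bexp (1 - (1 - r) ^ card N) (insert u U) h"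
    using insert assms insert.IH[of h] insert.IH[of "\<lambda>M. h (insert u M)"]
    by (simp add: bexp_eq_empty bexp_insert)
  finally show ?case .
qed simp

lemma bexp_card:
  assumes "finite D"
  shows "bexp r D (\<lambda>E. h (card E)) =
    (\<Sum>k\<le>card D. real (card D choose k) * r ^ k * (1 - r) ^ (card D - k) * h k)"
proof -
  let ?t = "\<lambda>k. r ^ k * (1 - r) ^ (card D - k) * h k"
  have "bexp r D (\<lambda>E. h (card E)) = (\<Sum>E\<in>Pow D. ?t (card E))"
    unfolding bexp_def using assms
    by (intro sum.cong) (auto simp: card_Diff_subset finite_subset)
  also have "\<dots> = (\<Sum>k\<le>card D. \<Sum>E\<in>{E \<in> Pow D. card E = k}. ?t (card E))"
    using assms by (intro sum.group[symmetric]) (auto simp: card_mono)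
  also have "\<dots> = (\<Sum>k\<le>card D. real (card D choose k) * ?t k)"
  proof (intro sum.cong refl)
    fix k
    have "(\<Sum>E\<in>{E \<in> Pow D. card E = k}. ?t (card E)) = (\<Sum>E\<in>{E \<in> Pow D. card E = k}. ?t k)"
      by (intro sum.cong) auto
    then show "(\<Sum>E\<in>{E \<in> Pow D. card E = k}. ?t (card E)) = real (card D choose k) * ?t k"
      using n_subsets[OF assms, of k] by (simp add: Pow_def)
  qed
  finally show ?thesis by (simp add: mult.assoc)
qed

text \<open>Link from the product measure to finite sums: a configuration is identified with the set
  of its present edges.\<close>

lemma prob_Pi_bernoulli:
  assumes "finite D" "0 \<le> p" "p \<le> 1"
  shows "measure_pmf.prob (Pi_pmf D False (\<lambda>_. bernoulli_pmf p)) {e. P {d \<in> D. e d}} =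
    bexp p D (\<lambda>E. of_bool (P E))"
proof -
  let ?M = "Pi_pmf D False (\<lambda>_. bernoulli_pmf p)"
  let ?F = "(\<lambda>E d. d \<in> E) ` Pow D"
  have inj: "inj_on (\<lambda>E d. d \<in> E) (Pow D)" by (auto simp: inj_on_def fun_eq_iff)
  \<comment> \<open>The default value \<open>False\<close> makes every configuration of positive
    probability the indicator of a subset of \<open>D\<close>.\<close>
  have sub: "set_pmf ?M \<subseteq> ?F"
  proof
    fix e assume "e \<in> set_pmf ?M"
    then have "\<forall>x. x \<notin> D \<longrightarrow> e x = False" using set_Pi_pmf_subset[OF assms(1), of False "\<lambda>_. bernoulli_pmf p"] by auto
    then have "{d. e d} \<in> Pow D" "e = (\<lambda>d. d \<in> {d. e d})" by auto
    then show "e \<in> ?F" by blast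
  qed
  have pmf: "pmf ?M (\<lambda>d. d \<in> E) = p ^ card E * (1 - p) ^ card (D - E)" if "E \<subseteq> D" for E
  proof -
    have "pmf ?M (\<lambda>d. d \<in> E) = (\<Prod>d\<in>D. if d \<in> E then p else 1 - p)"
      using that assms by (subst pmf_Pi') (auto intro!: prod.cong)
    also have "\<dots> = p ^ card (D \<inter> E) * (1 - p) ^ card (D - E)"
      using assms(1) by (simp add: prod.If_cases Diff_eq)
    finally show ?thesis using that by (simp add: Int_absorb1)
  qed
  have "measure_pmf.prob ?M {e. P {d \<in> D. e d}} = measure_pmf.prob ?M ({e. P {d \<in> D. e d}} \<inter> ?F)"
    using sub by (subst (1 2) measure_Int_set_pmf[symmetric]) (auto intro!: arg_cong[where f = "measure_pmf.prob ?M"])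
  also have "\<dots> = (\<Sum>e\<in>?F. pmf ?M e * of_bool (P {d \<in> D. e d}))"
    using assms(1) by (simp add: measure_measure_pmf_finite sum.inter_restrict if_distrib
        Int_commute of_bool_def cong: if_cong)
  also have "\<dots> = bexp p D (\<lambda>E. of_bool (P E))"
    unfolding sum.reindex[OF inj] bexp_def
  proof (intro sum.cong refl)
    fix E assume "E \<in> Pow D"
    then have "E \<subseteq> D" "{d \<in> D. d \<in> E} = E" by auto
    then show "((\<lambda>e. pmf ?M e * of_bool (P {d \<in> D. e d})) \<circ> (\<lambda>E d. d \<in> E)) E =
        p ^ card E * (1 - p) ^ card (D - E) * of_bool (P E)"
      by (simp add: pmf)
  qed
  finally show ?thesis .
qed

section \<open>Exploring a bipartite graph\<close>

text \<open>The condition says that every vertex of \<open>U\<close> and \<open>W\<close> is joined to \<open>S\<close> by edges of \<open>E\<close>, expressed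
  through the unions of components \<open>(P, Q)\<close> that contain \<open>S\<close> instead of through paths.\<close>
definition reach :: "'a set \<Rightarrow> 'a set \<Rightarrow> 'b set \<Rightarrow> ('a \<times> 'b) set \<Rightarrow> bool" where
  "reach S U W E \<longleftrightarrow>
    (\<forall>P Q. S \<subseteq> P \<and> (\<forall>u w. (u, w) \<in> E \<longrightarrow> (u \<in> P \<longleftrightarrow> w \<in> Q)) \<longrightarrow> U \<subseteq> P \<and> W \<subseteq> Q)"

text \<open>One step of the exploration: \<open>s\<close> discovers its neighbours \<open>N\<close>, these discover their
  neighbours \<open>fst ` G\<close> in \<open>U\<close>, and the edges \<open>F\<close> from \<open>N\<close> to known vertices are irrelevant.\<close>
lemma reach_step:
  assumes "s \<in> S" "S \<inter> U = {}"
    and N: "N \<subseteq> W" and F: "F \<subseteq> (S - {s}) \<times> N" and G: "G \<subseteq> U \<times> N"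
    and E: "E \<subseteq> (S - {s} \<union> U) \<times> (W - N)"
  shows "reach S U W ({s} \<times> N \<union> (F \<union> (G \<union> E))) \<longleftrightarrow>
    reach (S - {s} \<union> fst ` G) (U - fst ` G) (W - N) E" (is "reach S U W ?E \<longleftrightarrow> ?R")
proof
  assume L: "reach S U W ?E"
  show ?R
    unfolding reach_def
  proof (intro allI impI, elim conjE)
    fix P Q assume P: "S - {s} \<union> fst ` G \<subseteq> P" and cl: "\<forall>u w. (u, w) \<in> E \<longrightarrow> (u \<in> P \<longleftrightarrow> w \<in> Q)"
    \<comment> \<open>\<open>Q\<close> is corrected on \<open>N\<close>. This is harmless for
      \<open>E\<close>, whose edges avoid \<open>s\<close> and end in \<open>W - N\<close>.\<close>
    let ?P = "insert s P" and ?Q = "Q \<inter> (W - N) \<union> N"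
    have "S \<subseteq> ?P" using P by auto
    moreover have "\<forall>u w. (u, w) \<in> ?E \<longrightarrow> (u \<in> ?P \<longleftrightarrow> w \<in> ?Q)"
    proof (intro allI impI)
      fix u w assume "(u, w) \<in> ?E"
      then consider "u = s" "w \<in> N" | "(u, w) \<in> F" | "(u, w) \<in> G" | "(u, w) \<in> E" by auto
      then show "u \<in> ?P \<longleftrightarrow> w \<in> ?Q"
      proof cases
        case 2
        then show ?thesis using F P by auto
      next
        case 3
        then have "u \<in> fst ` G" "w \<in> N" using G by (force, auto)
        then show ?thesis using P by auto
      next
        case 4
        then have "u \<noteq> s" "w \<in> W - N" "u \<in> P \<longleftrightarrow> w \<in> Q" using E assms(1,2) cl by auto
        then show ?thesis by auto
      qed auto
    qed
    ultimately have "U \<subseteq> ?P \<and> W \<subseteq> ?Q" using L unfolding reach_def by blast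
    then show "U - fst ` G \<subseteq> P \<and> W - N \<subseteq> Q" using assms(1,2) by auto
  qed
next
  assume R: ?R
  show "reach S U W ?E"
    unfolding reach_def
  proof (intro allI impI, elim conjE)
    fix P Q assume P: "S \<subseteq> P" and cl: "\<forall>u w. (u, w) \<in> ?E \<longrightarrow> (u \<in> P \<longleftrightarrow> w \<in> Q)"
    have N': "N \<subseteq> Q" using P cl assms(1) by auto
    have G': "fst ` G \<subseteq> P"
    proof
      fix u assume "u \<in> fst ` G"
      then obtain w where "(u, w) \<in> G" by auto
      then show "u \<in> P" using N' G cl by auto
    qed
    have "U - fst ` G \<subseteq> P \<and> W - N \<subseteq> Q"
      using R[unfolded reach_def, rule_format, of P Q] P cl G' by blast
    then show "U \<subseteq> P \<and> W \<subseteq> Q" using N' G' by blast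
  qed
qed

text \<open>\<open>S\<close> is the queue, \<open>U\<close> and \<open>W\<close> are the
  undiscovered vertices. Edges at processed vertices or at discovered vertices of the second part
  have been dropped.\<close>

definition reach_prob :: "real \<Rightarrow> 'a set \<Rightarrow> 'a set \<Rightarrow> 'b set \<Rightarrow> real" where
  "reach_prob p S U W = bexp p ((S \<union> U) \<times> W) (\<lambda>E. of_bool (reach S U W E))"

text \<open>With an empty queue, the pair of empty sets is admissible in \<open>reach\<close> for
  every \<open>E\<close>.\<close>

lemma reach_prob_empty:
  assumes "finite U" "finite W"
  shows "reach_prob p {} U W = of_bool (U = {} \<and> W = {})"
proof -
  have "reach {} U W E \<longleftrightarrow> U = {} \<and> W = {}" for E :: "('a \<times> 'b) set"
    unfolding reach_def by blast
  then show ?thesis using assms by (simp add: reach_prob_def)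
qed

text \<open>The edges split into the disjoint blocks of \<open>reach_step\<close>. The irrelevant
  block averages out, and \<open>U \<times> N\<close> matters only through the vertices it
  discovers.\<close>

lemma reach_prob_step:
  assumes "finite S" "finite U" "finite W" "s \<in> S" "S \<inter> U = {}"
  shows "reach_prob p S U W = bexp p W (\<lambda>N. bexp (1 - (1 - p) ^ card N) U
    (\<lambda>M. reach_prob p (S - {s} \<union> M) (U - M) (W - N)))"
proof -
  let ?V = "S - {s} \<union> U" and ?r = "\<lambda>E. of_bool (reach S U W E) :: real"
  have "(S \<union> U) \<times> W = {s} \<times> W \<union> ?V \<times> W" using assms(4) by auto
  then have "reach_prob p S U W = bexp p W (\<lambda>N. bexp p (?V \<times> W) (\<lambda>E. ?r ({s} \<times> N \<union> E)))"
    unfolding reach_prob_def using assms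
    by (simp only:) (subst bexp_Un, auto simp: bexp_singleton_Times)
  also have "\<dots> = bexp p W (\<lambda>N. bexp (1 - (1 - p) ^ card N) U
    (\<lambda>M. reach_prob p (S - {s} \<union> M) (U - M) (W - N)))"
  proof (intro bexp_cong)
    fix N assume N: "N \<subseteq> W"
    have fin: "finite N" "finite (W - N)" using N assms finite_subset by auto
    have "?V \<times> W = (S - {s}) \<times> N \<union> (U \<times> N \<union> ?V \<times> (W - N))" using N by auto
    then have "bexp p (?V \<times> W) (\<lambda>E. ?r ({s} \<times> N \<union> E)) =
        bexp p ((S - {s}) \<times> N) (\<lambda>F. bexp p (U \<times> N) (\<lambda>G. bexp p (?V \<times> (W - N))
          (\<lambda>E. ?r ({s} \<times> N \<union> (F \<union> (G \<union> E))))))"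
    proof -
      have "bexp p (U \<times> N \<union> ?V \<times> (W - N)) g =
          bexp p (U \<times> N) (\<lambda>G. bexp p (?V \<times> (W - N)) (\<lambda>E. g (G \<union> E)))" for g
        using assms fin by (intro bexp_Un) auto
      moreover have "bexp p ((S - {s}) \<times> N \<union> (U \<times> N \<union> ?V \<times> (W - N))) g =
          bexp p ((S - {s}) \<times> N) (\<lambda>F. bexp p (U \<times> N \<union> ?V \<times> (W - N)) (\<lambda>E. g (F \<union> E)))" for g
        using assms fin by (intro bexp_Un) auto
      ultimately show ?thesis unfolding \<open>?V \<times> W = _\<close> by simp
    qed
    also have "\<dots> = bexp p ((S - {s}) \<times> N) (\<lambda>F. bexp p (U \<times> N) (\<lambda>G.
        reach_prob p (S - {s} \<union> fst ` G) (U - fst ` G) (W - N)))"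
    proof (intro bexp_cong)
      fix F G assume FG: "F \<subseteq> (S - {s}) \<times> N" "G \<subseteq> U \<times> N"
      then have "S - {s} \<union> fst ` G \<union> (U - fst ` G) = ?V" by auto
      then show "bexp p (?V \<times> (W - N)) (\<lambda>E. ?r ({s} \<times> N \<union> (F \<union> (G \<union> E)))) =
          reach_prob p (S - {s} \<union> fst ` G) (U - fst ` G) (W - N)"
        unfolding reach_prob_def using reach_step[OF assms(4,5) N FG] by (auto intro!: bexp_cong)
    qed
    also have "\<dots> = bexp (1 - (1 - p) ^ card N) U
        (\<lambda>M. reach_prob p (S - {s} \<union> M) (U - M) (W - N))"
      using assms fin
        bexp_Times_fst[where h = "\<lambda>M. reach_prob p (S - {s} \<union> M) (U - M) (W - N)", OF assms(2) fin(1)]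
      by simp
    finally show "bexp p (?V \<times> W) (\<lambda>E. ?r ({s} \<times> N \<union> E)) = bexp (1 - (1 - p) ^ card N) U
        (\<lambda>M. reach_prob p (S - {s} \<union> M) (U - M) (W - N))" .
  qed
  finally show ?thesis .
qed

text \<open>Induction along paths puts everything reachable from the root into any admissible pair;
  conversely, the vertices reachable from the root form such a pair.\<close>

lemma connected_bip_graph_iff:
  assumes "n \<ge> 1"
  shows "Digraph_Component.connected (with_proj (bip_graph n m e)) \<longleftrightarrow>
    reach {1} {2..n} {1..m} {ij \<in> {1..n} \<times> {1..m}. e ij}"
    (is "?C \<longleftrightarrow> reach _ _ _ ?E")
proof -
  let ?G = "with_proj (bip_graph n m e)" and ?V = "{1..n} <+> {1..m}"
  interpret G: pair_graph "bip_graph n m e" by (rule pair_graph_bip_graph)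
  have verts: "verts ?G = ?V" by (simp add: bip_graph_def)
  define A where "A = {(Inl i, Inr j) | i j. (i, j) \<in> ?E} \<union> {(Inr j, Inl i) | i j. (i, j) \<in> ?E}"
  have arcs: "parcs (bip_graph n m e) = A"
    by (auto simp: bip_graph_def A_def)
  have A: "(Inl i, Inr j) \<in> A" "(Inr j, Inl i) \<in> A" if "(i, j) \<in> ?E" for i j
    using that by (simp_all add: A_def)
  have sym: "symmetric ?G" by (rule G.sym_arcs)
  \<comment> \<open>Connectedness is strong connectedness of the symmetric closure, which has the
    same reachability as a symmetric graph.\<close>
  have conn: "?C \<longleftrightarrow> strongly_connected ?G"
    using G.reachable_mk_symmetric_eq[OF sym]
    by (simp add: Digraph_Component.connected_def strongly_connected_def)
  have root: "Inl 1 \<in> verts ?G"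
    unfolding verts using assms by (intro InlI) simp
  have step: "Inl 1 \<rightarrow>\<^sup>*\<^bsub>?G\<^esub> y" if "Inl 1 \<rightarrow>\<^sup>*\<^bsub>?G\<^esub> x" "(x, y) \<in> A" for x y
    using G.reachable_adj_trans[OF that(1)] that(2) by (simp only: arcs)
  show ?thesis
  proof
    assume ?C
    then have rch: "Inl 1 \<rightarrow>\<^sup>*\<^bsub>?G\<^esub> v" if "v \<in> ?V" for v
      using that root conn verts by (auto simp: strongly_connected_def)
    show "reach {1} {2..n} {1..m} ?E"
      unfolding reach_def
    proof (intro allI impI, elim conjE)
      fix P Q assume P: "{1} \<subseteq> P" and cl: "\<forall>u w. (u, w) \<in> ?E \<longrightarrow> (u \<in> P \<longleftrightarrow> w \<in> Q)"
      have *: "v \<in> P <+> Q" if "Inl 1 \<rightarrow>\<^sup>*\<^bsub>?G\<^esub> v" for v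
      proof -
        have "(Inl 1, v) \<in> A\<^sup>*" using reachable_rtranclI[OF that] arcs by simp
        then show ?thesis
        proof (induction rule: rtrancl_induct)
          case base
          then show ?case using P by auto
        next
          case (step y z)
          then show ?case using cl by (auto simp: A_def)
        qed
      qed
      have "i \<in> P" if "i \<in> {2..n}" for i using that *[OF rch[OF InlI[of i]]] by auto
      moreover have "j \<in> Q" if "j \<in> {1..m}" for j using that *[OF rch[OF InrI[of j]]] by auto
      ultimately show "{2..n} \<subseteq> P \<and> {1..m} \<subseteq> Q" by blast
    qed
  next
    assume R: "reach {1} {2..n} {1..m} ?E"
    let ?P = "{i. Inl 1 \<rightarrow>\<^sup>*\<^bsub>?G\<^esub> Inl i}" and ?Q = "{j. Inl 1 \<rightarrow>\<^sup>*\<^bsub>?G\<^esub> Inr j}"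
    have one: "1 \<in> ?P" using root by (auto intro: G.reachable_refl)
    have "\<forall>u w. (u, w) \<in> ?E \<longrightarrow> (u \<in> ?P \<longleftrightarrow> w \<in> ?Q)"
    proof (intro allI impI)
      fix u w assume "(u, w) \<in> ?E"
      note A[OF this]
      then show "u \<in> ?P \<longleftrightarrow> w \<in> ?Q"
        using step[of "Inl u" "Inr w"] step[of "Inr w" "Inl u"] by (simp only: mem_Collect_eq) blast
    qed
    then have sub: "{2..n} \<subseteq> ?P \<and> {1..m} \<subseteq> ?Q"
      using R[unfolded reach_def, rule_format, of ?P ?Q] one by simp
    have eq: "{1..n} = insert 1 {2..n}" using assms by auto
    have rch: "Inl 1 \<rightarrow>\<^sup>*\<^bsub>?G\<^esub> v" if "v \<in> verts ?G" for v
      using that sub one unfolding verts eq by (elim PlusE) blast+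
    have "strongly_connected ?G"
    proof
      show "verts ?G \<noteq> {}" using root by auto
      fix u v assume "u \<in> verts ?G" "v \<in> verts ?G"
      then show "u \<rightarrow>\<^sup>*\<^bsub>?G\<^esub> v"
        by (intro G.reachable_trans[OF symmetric_reachable[OF sym rch] rch])
    qed
    then show ?C using conn by simp
  qed
qed

lemma prob_connected_eq_reach_prob:
  assumes "n \<ge> 1" "0 \<le> p" "p \<le> 1"
  shows "prob_connected n m p = reach_prob p {1} {2..n} {1..m}"
proof -
  have "prob_connected n m p = measure_pmf.prob (Pi_pmf ({1..n} \<times> {1..m}) False (\<lambda>_. bernoulli_pmf p))
      {e. reach {1} {2..n} {1..m} {ij \<in> {1..n} \<times> {1..m}. e ij}}"
    by (simp add: prob_connected_def random_bip_graph_def vimage_def connected_bip_graph_iff[OF assms(1)])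
  also have "\<dots> = reach_prob p {1} {2..n} {1..m}"
  proof -
    have "{1} \<union> {2..n} = {1..n}" using assms(1) by auto
    then show ?thesis unfolding reach_prob_def using assms by (subst prob_Pi_bernoulli) auto
  qed
  finally show ?thesis .
qed

section \<open>Weighted walks\<close>

text \<open>Weak compositions of \<open>t\<close> into \<open>k\<close> parts; zero parts are
  allowed.\<close>

definition comps :: "nat \<Rightarrow> nat \<Rightarrow> nat list set" where
  "comps k t = {xs. length xs = k \<and> sum_list xs = t}"

lemma finite_comps [simp]: "finite (comps k t)"
proof (rule finite_subset)
  show "comps k t \<subseteq> {xs. set xs \<subseteq> {..t} \<and> length xs = k}"
    using member_le_sum_list by (fastforce simp: comps_def)
qed (simp add: finite_lists_length_eq)

lemma comps_0: "comps 0 t = (if t = 0 then {[]} else {})"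
  by (auto simp: comps_def)

lemma sum_comps_add:
  "(\<Sum>zs\<in>comps (k + l) t. f zs) = (\<Sum>y\<le>t. \<Sum>us\<in>comps k y. \<Sum>vs\<in>comps l (t - y). f (us @ vs))"
proof -
  have "(\<Sum>y\<le>t. \<Sum>us\<in>comps k y. \<Sum>vs\<in>comps l (t - y). f (us @ vs)) =
      (\<Sum>(y, us, vs)\<in>(SIGMA y:{..t}. comps k y \<times> comps l (t - y)). f (us @ vs))"
    by (simp add: sum.Sigma sum.cartesian_product split_def)
  also have "\<dots> = (\<Sum>zs\<in>comps (k + l) t. f zs)"
  proof (rule sum.reindex_bij_witness[where
        i = "\<lambda>zs. (sum_list (take k zs), take k zs, drop k zs)" and j = "\<lambda>(y, us, vs). us @ vs"])
    fix zs assume zs: "zs \<in> comps (k + l) t"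
    have "sum_list (take k zs) + sum_list (drop k zs) = sum_list zs"
      by (metis append_take_drop_id sum_list_append)
    then show "(sum_list (take k zs), take k zs, drop k zs) \<in> (SIGMA y:{..t}. comps k y \<times> comps l (t - y))"
      using zs by (auto simp: comps_def)
  qed (auto simp: comps_def)
  finally show ?thesis ..
qed

lemma sum_comps_Suc:
  "(\<Sum>zs\<in>comps (Suc k) t. f zs) = (\<Sum>x\<le>t. \<Sum>xs\<in>comps k (t - x). f (x # xs))"
proof -
  have "comps 1 y = {[y]}" for y by (auto simp: comps_def length_Suc_conv)
  then show ?thesis using sum_comps_add[of f 1 k t] by simp
qed

text \<open>Product of Poisson weights with rates \<open>c * q ^ i\<close>, stripped of their
  exponential factors. Positions start at 0.\<close>

definition wt :: "real \<Rightarrow> real \<Rightarrow> nat list \<Rightarrow> real" where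
  "wt q c xs = (\<Prod>i<length xs. (c * q ^ i) ^ (xs ! i) / fact (xs ! i))"

lemma wt_Nil [simp]: "wt q c [] = 1"
  by (simp add: wt_def)

lemma wt_Cons: "wt q c (x # xs) = c ^ x / fact x * wt q (c * q) xs"
  unfolding wt_def length_Cons prod.lessThan_Suc_shift by (simp add: mult_ac)

lemma wt_mult: "wt q (c * d) xs = d ^ sum_list xs * wt q c xs"
proof (induction xs arbitrary: c)
  case (Cons x xs)
  show ?case
    using Cons[of "c * q"]
    by (simp add: wt_Cons power_mult_distrib power_add mult_ac)
qed simp

text \<open>The tail starts at position \<open>length us\<close>, so each of its rates carries an
  extra factor \<open>q ^ length us\<close>.\<close>

lemma wt_append: "wt q c (us @ vs) = wt q c us * (q ^ (length us * sum_list vs) * wt q c vs)"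
proof (induction us arbitrary: c)
  case (Cons u us)
  then show ?case
    by (simp add: wt_Cons wt_mult[of q c q] power_add algebra_simps)
qed simp

text \<open>The multinomial theorem, by induction on the number of cells with the binomial
  theorem.\<close>

lemma sum_wt: "(\<Sum>xs\<in>comps k t. wt q c xs) = (c * (\<Sum>i<k. q ^ i)) ^ t / fact t"
proof (induction k arbitrary: t c)
  case 0
  then show ?case by (simp add: comps_0)
next
  case (Suc k)
  have S: "c * (\<Sum>i<Suc k. q ^ i) = c + c * q * (\<Sum>i<k. q ^ i)"
    by (simp only: sum.lessThan_Suc_shift) (simp add: sum_distrib_left algebra_simps)
  let ?d = "c * q * (\<Sum>i<k. q ^ i)"
  have "(\<Sum>xs\<in>comps (Suc k) t. wt q c xs) = (\<Sum>x\<le>t. c ^ x / fact x * (?d ^ (t - x) / fact (t - x)))"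
    by (simp only: sum_comps_Suc wt_Cons Suc flip: sum_distrib_left)
  also have "\<dots> = (\<Sum>x\<le>t. real (t choose x) * c ^ x * ?d ^ (t - x)) / fact t"
    by (auto simp: sum_divide_distrib binomial_fact intro!: sum.cong)
  also have "\<dots> = (c + ?d) ^ t / fact t"
    by (simp add: binomial_ring)
  finally show ?case unfolding S .
qed

lemma sum_wt_geometric: "(\<Sum>xs\<in>comps k t. wt (1 - p) p xs) = (1 - (1 - p) ^ k) ^ t / fact t"
  using one_diff_power_eq[of "1 - p" k] by (simp add: sum_wt)

text \<open>The lists \<open>xs\<close> and \<open>ys\<close> hold the values of the \<open>X i\<close> and \<open>Y j\<close>. For \<open>s = 1\<close> the condition is
  \<open>S k \<ge> 0\<close> for all \<open>k < n\<close>; in general \<open>s\<close> is the number of known but unprocessed vertices.\<close>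
definition stays_pos :: "nat \<Rightarrow> nat list \<Rightarrow> nat list \<Rightarrow> bool" where
  "stays_pos s xs ys \<longleftrightarrow> (\<forall>k<length xs. k < s + sum_list (take (sum_list (take k xs)) ys))"

lemma stays_pos_0_Cons: "\<not> stays_pos 0 (x # xs) ys"
  by (auto simp: stays_pos_def)

text \<open>The condition at \<open>k = 0\<close> holds as the queue is nonempty. At later
  \<open>k\<close> the initial segment of the second list contains all of \<open>us\<close>, and
  processing one vertex lowers the queue by one.\<close>

lemma stays_pos_Suc_Cons:
  assumes "length us = x"
  shows "stays_pos (Suc s) (x # xs) (us @ vs) \<longleftrightarrow> stays_pos (s + sum_list us) xs vs"
  unfolding stays_pos_def length_Cons All_less_Suc2 using assms by (simp add: add_ac)

text \<open>Unnormalised probability of the walk event with \<open>N\<close> steps and prescribed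
  totals \<open>b\<close> and \<open>a\<close>.\<close>

definition walk_sum :: "real \<Rightarrow> nat \<Rightarrow> nat \<Rightarrow> nat \<Rightarrow> nat \<Rightarrow> real" where
  "walk_sum p s N b a = (\<Sum>xs\<in>comps N b. \<Sum>ys\<in>comps b a.
     wt (1 - p) p xs * wt (1 - p) p ys * of_bool (stays_pos s xs ys))"

text \<open>With an empty queue the condition fails at \<open>k = 0\<close> as soon as a step is
  left; here \<open>a\<close> steps are left.\<close>

lemma walk_sum_0: "walk_sum p 0 a b a = of_bool (a = 0 \<and> b = 0)"
proof (cases a)
  case 0
  then show ?thesis by (auto simp: walk_sum_def comps_0 stays_pos_def)
next
  case (Suc a')
  then show ?thesis by (simp add: walk_sum_def sum_comps_Suc[of _ a'] stays_pos_0_Cons del: sum_mult_of_bool_eq)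
qed

text \<open>The first entry \<open>x\<close> of \<open>xs\<close> cuts off \<open>x\<close> entries
  of \<open>ys\<close>. They affect the rest only through their total \<open>y\<close>, so their
  weights sum up by \<open>sum_wt_geometric\<close>. The factors \<open>(1 - p) ^ (b - x)\<close>
  and \<open>((1 - p) ^ x) ^ (a - y)\<close> come from the shifted positions of the
  remainders.\<close>

lemma walk_sum_Suc:
  "walk_sum p (Suc s) (Suc N) b a = (\<Sum>x\<le>b. \<Sum>y\<le>a. p ^ x / fact x * (1 - p) ^ (b - x) *
     ((1 - (1 - p) ^ x) ^ y / fact y * ((1 - p) ^ x) ^ (a - y)) * walk_sum p (s + y) N (b - x) (a - y))"
proof -
  let ?q = "1 - p"
  have "walk_sum p (Suc s) (Suc N) b a = (\<Sum>x\<le>b. \<Sum>xs\<in>comps N (b - x). \<Sum>ys\<in>comps (x + (b - x)) a.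
      wt ?q p (x # xs) * wt ?q p ys * of_bool (stays_pos (Suc s) (x # xs) ys))"
    by (simp add: walk_sum_def sum_comps_Suc)
  also have "\<dots> = (\<Sum>x\<le>b. \<Sum>xs\<in>comps N (b - x). \<Sum>y\<le>a. \<Sum>us\<in>comps x y. \<Sum>vs\<in>comps (b - x) (a - y).
      wt ?q p (x # xs) * wt ?q p (us @ vs) * of_bool (stays_pos (Suc s) (x # xs) (us @ vs)))"
    by (simp only: sum_comps_add)
  also have "\<dots> = (\<Sum>x\<le>b. \<Sum>xs\<in>comps N (b - x). \<Sum>y\<le>a. \<Sum>us\<in>comps x y. \<Sum>vs\<in>comps (b - x) (a - y).
      wt ?q p us * (p ^ x / fact x * ?q ^ (b - x) * (?q ^ x) ^ (a - y) *
        (wt ?q p xs * wt ?q p vs * of_bool (stays_pos (s + y) xs vs))))"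
    by (intro sum.cong refl)
      (auto simp: comps_def wt_Cons wt_mult wt_append power_mult stays_pos_Suc_Cons)
  also have "\<dots> = (\<Sum>x\<le>b. \<Sum>xs\<in>comps N (b - x). \<Sum>y\<le>a. (\<Sum>us\<in>comps x y. wt ?q p us) *
      (p ^ x / fact x * ?q ^ (b - x) * (?q ^ x) ^ (a - y) *
        (\<Sum>vs\<in>comps (b - x) (a - y). wt ?q p xs * wt ?q p vs * of_bool (stays_pos (s + y) xs vs))))"
    by (simp only: flip: sum_distrib_left sum_distrib_right)
  also have "\<dots> = (\<Sum>x\<le>b. \<Sum>y\<le>a. \<Sum>xs\<in>comps N (b - x). (1 - ?q ^ x) ^ y / fact y *
      (p ^ x / fact x * ?q ^ (b - x) * (?q ^ x) ^ (a - y) *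
        (\<Sum>vs\<in>comps (b - x) (a - y). wt ?q p xs * wt ?q p vs * of_bool (stays_pos (s + y) xs vs))))"
    by (simp only: sum_wt_geometric sum.swap[where A = "comps _ _" and B = "{..a}"])
  also have "\<dots> = (\<Sum>x\<le>b. \<Sum>y\<le>a. p ^ x / fact x * ?q ^ (b - x) *
     ((1 - ?q ^ x) ^ y / fact y * (?q ^ x) ^ (a - y)) * walk_sum p (s + y) N (b - x) (a - y))"
    by (simp only: walk_sum_def sum_distrib_left mult_ac sum_divide_distrib times_divide_eq_right
        times_divide_eq_left divide_divide_eq_left)
  finally show ?thesis .
qed

text \<open>Both sides satisfy the same recursion and agree for an empty queue; the factorials turn
  the weights into binomial probabilities. Each step lowers the number of unprocessed vertices of
  the first part by one.\<close>

lemma reach_prob_eq_walk_sum: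
  assumes "finite S" "finite U" "finite W" "S \<inter> U = {}"
  shows "reach_prob p S U W =
    fact (card U) * fact (card W) * walk_sum p (card S) (card S + card U) (card W) (card U)"
  using assms
proof (induction "card S + card U" arbitrary: S U W rule: less_induct)
  case less
  show ?case
  proof (cases "S = {}")
    case True
    then show ?thesis using less.prems by (simp add: reach_prob_empty walk_sum_0)
  next
    case False
    then obtain s where s: "s \<in> S" by auto
    obtain k where k: "card S = Suc k" using False less.prems by (cases "card S") auto
    let ?a = "card U" and ?b = "card W" and ?q = "1 - p"
    \<comment> \<open>One vertex leaves the queue and \<open>y\<close> vertices move into it from
      \<open>U\<close>, so \<open>k + ?a\<close> steps remain whatever \<open>y\<close> is.\<close>
    let ?h = "\<lambda>x y. fact (?a - y) * fact (?b - x) * walk_sum p (k + y) (k + ?a) (?b - x) (?a - y)"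
    have IH: "reach_prob p (S - {s} \<union> M) (U - M) (W - N) = ?h (card N) (card M)"
      if "M \<subseteq> U" "N \<subseteq> W" for M N
    proof -
      have fin: "finite M" "finite N" using that less.prems(2,3) by (blast intro: finite_subset)+
      have "card M \<le> card U" using that less.prems by (simp add: card_mono)
      moreover have "card (S - {s} \<union> M) = k + card M"
        using that less.prems s k fin by (subst card_Un_disjoint) auto
      moreover have "card (U - M) = ?a - card M" "card (W - N) = ?b - card N"
        using that fin by (simp_all add: card_Diff_subset)
      ultimately show ?thesis
        using less.hyps[of "S - {s} \<union> M" "U - M" "W - N"] less.prems k fin by auto
    qed
    have "reach_prob p S U W = bexp p W (\<lambda>N. bexp (1 - ?q ^ card N) U (\<lambda>M. ?h (card N) (card M)))"
      unfolding reach_prob_step[OF less.prems(1-3) s less.prems(4)] by (intro bexp_cong IH)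
    also have "\<dots> = (\<Sum>x\<le>?b. real (?b choose x) * p ^ x * ?q ^ (?b - x) *
        (\<Sum>y\<le>?a. real (?a choose y) * (1 - ?q ^ x) ^ y * (1 - (1 - ?q ^ x)) ^ (?a - y) * ?h x y))"
      unfolding bexp_card[OF less.prems(2), where h = "?h _"]
      by (rule bexp_card[OF less.prems(3)])
    also have "\<dots> = fact ?a * fact ?b * walk_sum p (card S) (card S + card U) (card W) (card U)"
      unfolding k add_Suc walk_sum_Suc sum_distrib_left
    proof (intro sum.cong refl)
      fix x y assume "x \<in> {..?b}" "y \<in> {..?a}"
      then have fact_b: "fact ?b = real (?b choose x) * (fact x * fact (?b - x))"
        and fact_a: "fact ?a = real (?a choose y) * (fact y * fact (?a - y))"
        by (simp_all add: binomial_fact)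
      show "real (?b choose x) * p ^ x * ?q ^ (?b - x) *
          (real (?a choose y) * (1 - ?q ^ x) ^ y * (1 - (1 - ?q ^ x)) ^ (?a - y) * ?h x y) =
        fact ?a * fact ?b * (p ^ x / fact x * ?q ^ (?b - x) *
          ((1 - ?q ^ x) ^ y / fact y * (?q ^ x) ^ (?a - y)) * walk_sum p (k + y) (k + ?a) (?b - x) (?a - y))"
        unfolding fact_a fact_b by simp
    qed
    finally show ?thesis .
  qed
qed

section \<open>Poisson variables\<close>

text \<open>By \<open>0 ^ 0 = 1\<close> the usual formula also covers the point mass at rate
  0.\<close>

lemma pmf_poiss: "0 \<le> r \<Longrightarrow> pmf (poiss r) k = r ^ k / fact k * exp (- r)"
  by (cases "k = 0") (auto simp: poiss_def)

text \<open>The factor \<open>c\<close> enters only through the total of \<open>xs\<close>, hence is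
  constant once that total is fixed.\<close>

lemma prod_pmf_poiss:
  assumes "0 \<le> c" "0 \<le> p" "p \<le> 1" "length xs = N" "\<And>i. a i = c * p * (1 - p) ^ (i - 1)"
  shows "(\<Prod>i\<in>{1..N}. pmf (poiss (a i)) (xs ! (i - 1))) =
    exp (- (\<Sum>i=1..N. a i)) * c ^ sum_list xs * wt (1 - p) p xs"
proof -
  have "(\<Prod>i\<in>{1..N}. pmf (poiss (a i)) (xs ! (i - 1))) =
      (\<Prod>i\<in>{1..N}. exp (- a i)) *
      (\<Prod>i\<in>{1..N}. (p * c * (1 - p) ^ (i - 1)) ^ (xs ! (i - 1)) / fact (xs ! (i - 1)))"
    using assms by (simp add: pmf_poiss mult_ac flip: prod.distrib)
  also have "(\<Prod>i\<in>{1..N}. exp (- a i)) = exp (- (\<Sum>i=1..N. a i))"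
    by (simp add: exp_sum sum_negf[symmetric])
  also have "(\<Prod>i\<in>{1..N}. (p * c * (1 - p) ^ (i - 1)) ^ (xs ! (i - 1)) / fact (xs ! (i - 1))) = wt (1 - p) (p * c) xs"
    using assms(4) by (simp add: wt_def prod.atLeast1_atMost_eq)
  finally show ?thesis by (simp add: wt_mult)
qed

lemma (in prob_space) prob_lists_eq:
  fixes X Y :: "nat \<Rightarrow> 'a \<Rightarrow> nat"
  assumes "n \<ge> 1"
    and indep: "indep_vars (\<lambda>_. count_space UNIV) (case_sum X Y) ({1..n} <+> {1..m})"
    and X: "\<And>i. i \<in> {1..n} \<Longrightarrow> distr M (count_space UNIV) (X i) = measure_pmf (f i)"
    and Y: "\<And>j. j \<in> {1..m} \<Longrightarrow> distr M (count_space UNIV) (Y j) = measure_pmf (g j)"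
    and len: "length xs = n" "length ys = m"
  defines "V \<equiv> {\<omega> \<in> space M. map (\<lambda>i. X i \<omega>) [1..<Suc n] = xs \<and> map (\<lambda>j. Y j \<omega>) [1..<Suc m] = ys}"
  shows "V \<in> events"
    and "prob V = (\<Prod>i\<in>{1..n}. pmf (f i) (xs ! (i - 1))) * (\<Prod>j\<in>{1..m}. pmf (g j) (ys ! (j - 1)))"
proof -
  let ?I = "{1..n} <+> {1..m}" and ?Z = "case_sum X Y"
  let ?x = "case_sum (\<lambda>i. xs ! (i - 1)) (\<lambda>j. ys ! (j - 1))"
  have rv: "?Z i \<in> measurable M (count_space UNIV)" if "i \<in> ?I" for i
    using indep that unfolding indep_vars_def by blast
  have list_eq: "map h [1..<Suc k] = zs \<longleftrightarrow> (\<forall>i\<in>{1..k}. h i = zs ! (i - 1))" if "length zs = k"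
    for h :: "nat \<Rightarrow> nat" and k zs
  proof -
    have "map h [1..<Suc k] = zs \<longleftrightarrow> (\<forall>i<k. h (Suc i) = zs ! i)"
      using that by (auto simp: list_eq_iff_nth_eq simp del: upt_Suc)
    also have "\<dots> \<longleftrightarrow> (\<forall>i\<in>{1..k}. h i = zs ! (i - 1))"
      unfolding image_Suc_lessThan[symmetric] by auto
    finally show ?thesis .
  qed
  have ne: "?I \<noteq> {}" using assms(1) by auto
  \<comment> \<open>One condition per variable over the joint index set, as mutual independence
    requires.\<close>
  have V: "V = (\<Inter>i\<in>?I. ?Z i -` {?x i} \<inter> space M)"
    unfolding V_def list_eq[OF len(1)] list_eq[OF len(2)] using ne by (auto simp: Plus_def ball_Un)
  show "V \<in> events"
    unfolding V using ne by (intro sets.finite_INT measurable_sets[OF rv]) auto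
  have "prob V = (\<Prod>i\<in>?I. prob (?Z i -` {?x i} \<inter> space M))"
    unfolding V by (rule indep_varsD_finite[OF indep]) (use ne in auto)
  also have "\<dots> = (\<Prod>i\<in>{1..n}. prob (X i -` {xs ! (i - 1)} \<inter> space M)) *
      (\<Prod>j\<in>{1..m}. prob (Y j -` {ys ! (j - 1)} \<inter> space M))"
    by (simp add: prod.Plus)
  also have "(\<Prod>i\<in>{1..n}. prob (X i -` {xs ! (i - 1)} \<inter> space M)) = (\<Prod>i\<in>{1..n}. pmf (f i) (xs ! (i - 1)))"
  proof (intro prod.cong refl)
    fix i assume i: "i \<in> {1..n}"
    show "prob (X i -` {xs ! (i - 1)} \<inter> space M) = pmf (f i) (xs ! (i - 1))"
      using rv[OF InlI[OF i]] i
      by (subst measure_distr[symmetric, where N = "count_space UNIV"]) (auto simp: X pmf.rep_eq)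
  qed
  also have "(\<Prod>j\<in>{1..m}. prob (Y j -` {ys ! (j - 1)} \<inter> space M)) = (\<Prod>j\<in>{1..m}. pmf (g j) (ys ! (j - 1)))"
  proof (intro prod.cong refl)
    fix j assume j: "j \<in> {1..m}"
    show "prob (Y j -` {ys ! (j - 1)} \<inter> space M) = pmf (g j) (ys ! (j - 1))"
      using rv[OF InrI[OF j]] j
      by (subst measure_distr[symmetric, where N = "count_space UNIV"]) (auto simp: Y pmf.rep_eq)
  qed
  finally show "prob V = (\<Prod>i\<in>{1..n}. pmf (f i) (xs ! (i - 1))) * (\<Prod>j\<in>{1..m}. pmf (g j) (ys ! (j - 1)))" .
qed

text \<open>As \<open>A k \<le> A n = m\<close>, the list of the \<open>y j\<close> is long enough
  for \<open>take\<close> to yield \<open>B (A k)\<close>. Starting at 1 turns the strict inequality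
  into \<open>k \<le> B (A k)\<close>, trivial at \<open>k = 0\<close>.\<close>

lemma stays_pos_1_iff:
  fixes x y A B :: "nat \<Rightarrow> nat"
  assumes A: "\<And>k. A k = (\<Sum>i=1..k. x i)" and B: "\<And>k. B k = (\<Sum>j=1..k. y j)" and "A n = m"
  shows "stays_pos 1 (map x [1..<Suc n]) (map y [1..<Suc m]) \<longleftrightarrow> (\<forall>k. 0 < k \<and> k < n \<longrightarrow> k \<le> B (A k))"
proof -
  have take: "sum_list (take k (map z [1..<Suc l])) = (\<Sum>i=1..k. z i)" if "k \<le> l" for z :: "nat \<Rightarrow> nat" and k l
  proof -
    have "take k (map z [1..<Suc l]) = map z [1..<Suc k]"
      using that by (simp add: take_map take_upt del: upt_Suc)
    then show ?thesis
      by (simp only: interv_sum_list_conv_sum_set_nat set_upt atLeastLessThanSuc_atLeastAtMost)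
  qed
  have "A k \<le> m" if "k < n" for k
    using that unfolding A \<open>A n = m\<close>[symmetric] by (intro sum_mono2) auto
  then have "sum_list (take (sum_list (take k (map x [1..<Suc n]))) (map y [1..<Suc m])) = B (A k)"
    if "k < n" for k using that by (simp only: take less_imp_le A[symmetric] B[symmetric])
  then have "stays_pos 1 (map x [1..<Suc n]) (map y [1..<Suc m]) \<longleftrightarrow> (\<forall>k<n. k \<le> B (A k))"
    unfolding stays_pos_def by (auto simp: less_Suc_eq_le simp del: upt_Suc)
  then show ?thesis
    by (metis le0 neq0_conv)
qed

section \<open>The conditional probability as a quotient of weighted sums\<close>

theorem lemma2p2:
  fixes n m :: nat and p :: real
    and M :: "'w measure" and X Y :: "nat \<Rightarrow> 'w \<Rightarrow> nat"
    and \<alpha> \<beta> :: "nat \<Rightarrow> real"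
    and A B :: "nat \<Rightarrow> 'w \<Rightarrow> nat" and S :: "nat \<Rightarrow> 'w \<Rightarrow> int"
  assumes "n \<ge> 1" and "m \<ge> 1" and "0 < p" and "p \<le> 1"
    and "prob_space M"
    and "\<And>i. \<alpha> i = real m * p / (1 - (1 - p) ^ n) * (1 - p) ^ (i - 1)"
    and "\<And>j. \<beta> j = real n * p / (1 - (1 - p) ^ m) * (1 - p) ^ (j - 1)"
    and "prob_space.indep_vars M (\<lambda>_. count_space UNIV) (case_sum X Y) ({1..n} <+> {1..m})"
    and "\<And>i. i \<in> {1..n} \<Longrightarrow> distr M (count_space UNIV) (X i) = measure_pmf (poiss (\<alpha> i))"
    and "\<And>j. j \<in> {1..m} \<Longrightarrow> distr M (count_space UNIV) (Y j) = measure_pmf (poiss (\<beta> j))"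
    and "\<And>k \<omega>. A k \<omega> = (\<Sum>i=1..k. X i \<omega>)"
    and "\<And>k \<omega>. B k \<omega> = (\<Sum>j=1..k. Y j \<omega>)"
    and "\<And>k \<omega>. S k \<omega> = int (B (A k \<omega>) \<omega>) - int k"
  shows "prob_connected n m p =
           (1 - (1 - p) ^ n) ^ m * (1 - (1 - p) ^ m) ^ (n - 1) *
           \<P>(\<omega> in M. (\<forall>k. 0 < k \<and> k < n \<longrightarrow> S k \<omega> \<ge> 0) \<bar> A n \<omega> = m \<and> B m \<omega> = n - 1)"
proof -
  interpret prob_space M by fact
  let ?q = "1 - p"
  let ?x = "\<lambda>\<omega>. map (\<lambda>i. X i \<omega>) [1..<Suc n]" and ?y = "\<lambda>\<omega>. map (\<lambda>j. Y j \<omega>) [1..<Suc m]"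
  define u where "u = 1 - ?q ^ n"
  define v where "v = 1 - ?q ^ m"
  have "?q ^ n < 1" "?q ^ m < 1" using assms(1-4) by (simp_all add: power_less_one_iff)
  then have uv: "0 < u" "0 < v" by (simp_all add: u_def v_def)
  \<comment> \<open>\<open>K\<close> collects the factors that are constant on the conditioning
    event; it cancels in the quotient.\<close>
  define K where "K = exp (- (\<Sum>i=1..n. \<alpha> i)) * (m / u) ^ m * (exp (- (\<Sum>j=1..m. \<beta> j)) * (n / v) ^ (n - 1))"
  have K: "K > 0" unfolding K_def using uv assms(1,2) by simp
  have \<alpha>: "\<alpha> i = m / u * p * ?q ^ (i - 1)" for i by (simp add: assms(6) u_def)
  have \<beta>: "\<beta> j = n / v * p * ?q ^ (j - 1)" for j by (simp add: assms(7) v_def)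
  have x_comps: "?x \<omega> \<in> comps n m \<longleftrightarrow> A n \<omega> = m" and y_comps: "?y \<omega> \<in> comps m (n - 1) \<longleftrightarrow> B m \<omega> = n - 1" for \<omega>
    by (simp_all only: comps_def mem_Collect_eq length_map length_upt interv_sum_list_conv_sum_set_nat
        set_upt atLeastLessThanSuc_atLeastAtMost assms(11,12) diff_Suc_1 simp_thms)
  \<comment> \<open>A general \<open>Q\<close> serves both the numerator
    (\<open>stays_pos 1\<close>) and the denominator (always true).\<close>
  have sum_prob: "\<P>(\<omega> in M. Q (?x \<omega>) (?y \<omega>) \<and> A n \<omega> = m \<and> B m \<omega> = n - 1) =
      K * (\<Sum>xs\<in>comps n m. \<Sum>ys\<in>comps m (n - 1). wt ?q p xs * wt ?q p ys * of_bool (Q xs ys))" for Q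
  proof -
    let ?V = "\<lambda>(xs, ys). {\<omega> \<in> space M. ?x \<omega> = xs \<and> ?y \<omega> = ys}"
    let ?C = "comps n m \<times> comps m (n - 1)"
    let ?J = "{(xs, ys) \<in> ?C. Q xs ys}"
    have fin: "finite ?J" by (rule finite_subset[of _ ?C]) auto
    have V: "?V z \<in> events \<and> prob (?V z) = K * (wt ?q p (fst z) * wt ?q p (snd z))" if "z \<in> ?C" for z
    proof -
      obtain xs ys where z: "z = (xs, ys)" by (cases z)
      then have len: "length xs = n" "length ys = m" "sum_list xs = m" "sum_list ys = n - 1"
        using that by (auto simp: comps_def)
      note V = prob_lists_eq[OF assms(1,8,9,10) len(1,2)]
      have "(\<Prod>i\<in>{1..n}. pmf (poiss (\<alpha> i)) (xs ! (i - 1))) =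
          exp (- (\<Sum>i=1..n. \<alpha> i)) * (m / u) ^ m * wt ?q p xs"
        unfolding len(3)[symmetric] using assms(3,4) uv len \<alpha> by (intro prod_pmf_poiss) auto
      moreover have "(\<Prod>j\<in>{1..m}. pmf (poiss (\<beta> j)) (ys ! (j - 1))) =
          exp (- (\<Sum>j=1..m. \<beta> j)) * (n / v) ^ (n - 1) * wt ?q p ys"
        unfolding len(4)[symmetric] using assms(3,4) uv len \<beta> by (intro prod_pmf_poiss) auto
      ultimately show ?thesis
        using V unfolding z K_def by (simp only: split_conv fst_conv snd_conv mult_ac simp_thms)
    qed
    have "{\<omega> \<in> space M. Q (?x \<omega>) (?y \<omega>) \<and> A n \<omega> = m \<and> B m \<omega> = n - 1} = (\<Union>z\<in>?J. ?V z)"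
      unfolding x_comps[symmetric] y_comps[symmetric] by blast
    then have "\<P>(\<omega> in M. Q (?x \<omega>) (?y \<omega>) \<and> A n \<omega> = m \<and> B m \<omega> = n - 1) = (\<Sum>z\<in>?J. prob (?V z))"
      using fin V by (simp only:) (intro finite_measure_finite_Union; fastforce simp: disjoint_family_on_def)
    also have "\<dots> = (\<Sum>z\<in>?J. K * (wt ?q p (fst z) * wt ?q p (snd z)))"
      using V by (intro sum.cong) auto
    also have "\<dots> = (\<Sum>z\<in>?C. K * (wt ?q p (fst z) * wt ?q p (snd z) * of_bool (Q (fst z) (snd z))))"
      by (intro sum.mono_neutral_cong_left) auto
    finally show ?thesis by (simp only: sum.cartesian_product split_def sum_distrib_left)
  qed
  have good: "\<P>(\<omega> in M. (\<forall>k. 0 < k \<and> k < n \<longrightarrow> S k \<omega> \<ge> 0) \<and> A n \<omega> = m \<and> B m \<omega> = n - 1) =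
      K * walk_sum p 1 n m (n - 1)"
  proof -
    have S: "S k \<omega> \<ge> 0 \<longleftrightarrow> k \<le> B (A k \<omega>) \<omega>" for k \<omega>
      using assms(13) by simp
    \<comment> \<open>The equivalence needs \<open>A n \<omega> = m\<close>, so it is applied only
      inside the conditioning event.\<close>
    have "(\<forall>k. 0 < k \<and> k < n \<longrightarrow> S k \<omega> \<ge> 0) \<longleftrightarrow> stays_pos 1 (?x \<omega>) (?y \<omega>)" if "A n \<omega> = m" for \<omega>
      using stays_pos_1_iff[of "\<lambda>k. A k \<omega>" "\<lambda>i. X i \<omega>" "\<lambda>k. B k \<omega>" "\<lambda>j. Y j \<omega>" n m,
          OF assms(11,12) that]
      by (simp only: S)
    then have "{\<omega> \<in> space M. (\<forall>k. 0 < k \<and> k < n \<longrightarrow> S k \<omega> \<ge> 0) \<and> A n \<omega> = m \<and> B m \<omega> = n - 1} =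
        {\<omega> \<in> space M. stays_pos 1 (?x \<omega>) (?y \<omega>) \<and> A n \<omega> = m \<and> B m \<omega> = n - 1}"
      by blast
    then show ?thesis unfolding walk_sum_def by (simp only: sum_prob)
  qed
  have total: "\<P>(\<omega> in M. A n \<omega> = m \<and> B m \<omega> = n - 1) = K * (u ^ m / fact m * (v ^ (n - 1) / fact (n - 1)))"
    using sum_prob[of "\<lambda>_ _. True"]
    by (simp add: sum_wt_geometric u_def v_def flip: sum_product)
  have "prob_connected n m p = fact (n - 1) * fact m * walk_sum p 1 n m (n - 1)"
    using assms(1-4) by (simp add: prob_connected_eq_reach_prob reach_prob_eq_walk_sum)
  also have "\<dots> = u ^ m * v ^ (n - 1) *
      (K * walk_sum p 1 n m (n - 1) / (K * (u ^ m / fact m * (v ^ (n - 1) / fact (n - 1)))))"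
    using K uv by (simp add: field_simps)
  finally show ?thesis
    unfolding cond_prob_def good total u_def v_def .
qed

end
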